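(* Let $\{A_i\}$ be an inverse system of abelian groups indexed by $\mathbb{N}$ such that all the maps $A_{i+1} \to A_i$ are surjective. Then the natural map $\mathrm{Tor}(\varprojlim A_i,\varprojlim A_i) \to \varprojlim \mathrm{Tor}(A_i,A_i)$ is injective.
   Context: $\mathrm{Tor}$ denotes $\mathrm{Tor}_1^{\mathbb{Z}}$. *)

theory Defs
  imports "HOL-Algebra.Free_Abelian_Groups" "HOL-Algebra.Generated_Groups"
begin

text \<open>Abelian groups are the (multiplicatively written) \<^locale>\<open>comm_group\<close>s of HOL-Algebra.\<close>

section \<open>Inverse systems over the natural numbers and their limits\<close>

text \<open>\<open>f i j\<close> is the transition map \<open>A j \<rightarrow> A i\<close> for \<open>i \<le> j\<close>; its values for
  \<open>i > j\<close> or outside the carrier are irrelevant.\<close>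

locale inverse_system =
  fixes A :: "nat \<Rightarrow> ('a, 'b) monoid_scheme" and f :: "nat \<Rightarrow> nat \<Rightarrow> 'a \<Rightarrow> 'a"
  assumes comm_group: "comm_group (A i)"
    and hom: "i \<le> j \<Longrightarrow> f i j \<in> hom (A j) (A i)"
    and id: "x \<in> carrier (A i) \<Longrightarrow> f i i x = x"
    and comp: "\<lbrakk>i \<le> j; j \<le> k; x \<in> carrier (A k)\<rbrakk> \<Longrightarrow> f i j (f j k x) = f i k x"

definition inverse_limit ::
    "(nat \<Rightarrow> ('a, 'b) monoid_scheme) \<Rightarrow> (nat \<Rightarrow> nat \<Rightarrow> 'a \<Rightarrow> 'a) \<Rightarrow> (nat \<Rightarrow> 'a) monoid" where
  "inverse_limit A f = (product_group UNIV A)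
     \<lparr>carrier := {x \<in> carrier (product_group UNIV A). \<forall>i j. i \<le> j \<longrightarrow> f i j (x j) = x i}\<rparr>"

section \<open>Tensor product over the integers\<close>

definition tensor_relations ::
    "('a, 'm) monoid_scheme \<Rightarrow> ('b, 'n) monoid_scheme \<Rightarrow> ('a \<times> 'b \<Rightarrow>\<^sub>0 int) set" where
  "tensor_relations A B = generate (free_Abelian_group (carrier A \<times> carrier B))
     ({frag_of (a \<otimes>\<^bsub>A\<^esub> a', b) - frag_of (a, b) - frag_of (a', b) | a a' b.
         a \<in> carrier A \<and> a' \<in> carrier A \<and> b \<in> carrier B} \<union>
      {frag_of (a, b \<otimes>\<^bsub>B\<^esub> b') - frag_of (a, b) - frag_of (a, b') | a b b'.
         a \<in> carrier A \<and> b \<in> carrier B \<and> b' \<in> carrier B})"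

definition tensor ::
    "('a, 'm) monoid_scheme \<Rightarrow> ('b, 'n) monoid_scheme \<Rightarrow> ('a \<times> 'b \<Rightarrow>\<^sub>0 int) set monoid" where
  "tensor A B = free_Abelian_group (carrier A \<times> carrier B) Mod tensor_relations A B"

definition free_map :: "('a \<Rightarrow> 'b) \<Rightarrow> ('a \<Rightarrow>\<^sub>0 int) \<Rightarrow> ('b \<Rightarrow>\<^sub>0 int)" where
  "free_map h = frag_extend (frag_of \<circ> h)"

text \<open>The map \<open>f \<otimes> g\<close> into \<open>tensor A' B'\<close> for homomorphisms \<open>f : A \<rightarrow> A'\<close> and
  \<open>g : B \<rightarrow> B'\<close>: for such \<open>f, g\<close> all representatives of a coset \<open>X\<close> are sent to the same coset.\<close>

definition tensor_map ::
    "('c, 'm) monoid_scheme \<Rightarrow> ('d, 'n) monoid_scheme \<Rightarrow> ('a \<Rightarrow> 'c) \<Rightarrow> ('b \<Rightarrow> 'd) \<Rightarrow>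
     ('a \<times> 'b \<Rightarrow>\<^sub>0 int) set \<Rightarrow> ('c \<times> 'd \<Rightarrow>\<^sub>0 int) set" where
  "tensor_map A' B' f g X = the_elem
     ((\<lambda>x. tensor_relations A' B' #>\<^bsub>free_Abelian_group (carrier A' \<times> carrier B')\<^esub>
             free_map (map_prod f g) x) ` X)"

section \<open>The functor Tor\<close>

text \<open>The functorial free resolution \<open>0 \<rightarrow> K(A) \<rightarrow> \<int>[A] \<rightarrow> A \<rightarrow> 0\<close>, where \<open>\<int>[A]\<close> is the
  free abelian group on the underlying set of \<open>A\<close>, \<open>\<int>[A] \<rightarrow> A\<close> is the homomorphism extending
  the identity, and \<open>K(A)\<close> is its kernel, again free as a subgroup of a free abelian group.\<close>

definition free_eval :: "('a, 'm) monoid_scheme \<Rightarrow> ('a \<Rightarrow>\<^sub>0 int) \<Rightarrow> 'a" where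
  "free_eval A x = (\<Otimes>\<^bsub>A\<^esub>a\<in>Poly_Mapping.keys x. a [^]\<^bsub>A\<^esub> Poly_Mapping.lookup x a)"

definition resolution0 :: "('a, 'm) monoid_scheme \<Rightarrow> ('a \<Rightarrow>\<^sub>0 int) monoid" where
  "resolution0 A = free_Abelian_group (carrier A)"

definition resolution1 :: "('a, 'm) monoid_scheme \<Rightarrow> ('a \<Rightarrow>\<^sub>0 int) monoid" where
  "resolution1 A = (resolution0 A)\<lparr>carrier := kernel (resolution0 A) A (free_eval A)\<rparr>"

text \<open>\<open>Tor\<^sub>1(A, B)\<close> is the first homology of \<open>0 \<rightarrow> K(A) \<otimes> B \<rightarrow> \<int>[A] \<otimes> B \<rightarrow> 0\<close>.\<close>

definition tor ::
    "('a, 'm) monoid_scheme \<Rightarrow> ('b, 'n) monoid_scheme \<Rightarrow> (('a \<Rightarrow>\<^sub>0 int) \<times> 'b \<Rightarrow>\<^sub>0 int) set monoid" where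
  "tor A B = (tensor (resolution1 A) B)
     \<lparr>carrier := kernel (tensor (resolution1 A) B) (tensor (resolution0 A) B)
                   (tensor_map (resolution0 A) B id id)\<rparr>"

text \<open>\<open>Tor\<^sub>1(f, g)\<close> for \<open>f : A \<rightarrow> A'\<close>, \<open>g : B \<rightarrow> B'\<close>; the chain map of resolutions
  lifting \<open>f\<close> is \<open>\<int>[f] = free_map f\<close> and its restriction to the kernels.\<close>

definition tor_map ::
    "('c, 'm) monoid_scheme \<Rightarrow> ('d, 'n) monoid_scheme \<Rightarrow> ('a \<Rightarrow> 'c) \<Rightarrow> ('b \<Rightarrow> 'd) \<Rightarrow>
     (('a \<Rightarrow>\<^sub>0 int) \<times> 'b \<Rightarrow>\<^sub>0 int) set \<Rightarrow> (('c \<Rightarrow>\<^sub>0 int) \<times> 'd \<Rightarrow>\<^sub>0 int) set" where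
  "tor_map A' B' f g = tensor_map (resolution1 A') B' (free_map f) g"

end

theory Submission
  imports Defs HOL.Modules
begin

text \<open>
  Write \<open>L\<close> for the limit. Already \<open>K(L) \<otimes> L \<rightarrow> lim (K(A\<^sub>i) \<otimes> A\<^sub>i)\<close> is injective. An element of
  \<open>K(L) \<otimes> L\<close> involves only finitely many elements \<open>S\<close> of \<open>L\<close>. The group \<open>M = K(L) \<inter> \<int>[S]\<close> is
  finitely generated and free, so the element is \<open>\<Sum> k \<otimes> \<beta>\<^sub>k\<close> with \<open>k\<close> running over a basis of \<open>M\<close>.
  The torsion subgroup of the subgroup of \<open>L\<close> generated by \<open>S\<close> is finite, so for large \<open>i\<close> both it
  and \<open>S\<close> are mapped injectively to \<open>A\<^sub>i\<close>, and then the image of \<open>M\<close> in \<open>K(A\<^sub>i)\<close> is a pure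
  subgroup. A pure finitely generated subgroup is a direct summand of every finitely generated
  group containing it, and vanishing in a tensor product only involves a finitely generated
  subgroup of \<open>K(A\<^sub>i)\<close>. Hence, if the element vanishes in \<open>K(A\<^sub>i) \<otimes> A\<^sub>i\<close>, each \<open>\<beta>\<^sub>k\<close> vanishes
  in \<open>A\<^sub>i\<close>; for all large \<open>i\<close> together this gives \<open>\<beta>\<^sub>k = 0\<close>.
\<close>

section \<open>Subgroups of free abelian groups\<close>

text \<open>Subgroups of a free abelian group are its submodules over the integers, so
  \<open>span\<close>, \<open>independent\<close> and \<open>representation\<close> of module theory
  apply to them.\<close>

interpretation frag: module frag_cmul
  by unfold_locales (simp_all add: frag_cmul_distrib frag_cmul_distrib2)

\<comment> \<open>it would loop with \<open>frag.scale_minus_left\<close>\<close>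
declare minus_frag_cmul [simp del]

lemma frag_subspace_keys: "frag.subspace {u. Poly_Mapping.keys u \<subseteq> S}"
  by (rule frag.subspaceI) (auto dest!: subsetD[OF keys_add])

text \<open>Induction on \<open>S\<close>: the coefficients at a new element \<open>s\<close> form
  an ideal of the integers. A member of \<open>H\<close> whose coefficient there is nonzero and
  least in absolute value, together with generators of the members vanishing at \<open>s\<close>,
  generates \<open>H\<close>.\<close>

lemma frag_subspace_finitely_generated:
  fixes H :: "('a \<Rightarrow>\<^sub>0 int) set"
  assumes "finite S" "frag.subspace H" "\<And>u. u \<in> H \<Longrightarrow> Poly_Mapping.keys u \<subseteq> S"
  shows "\<exists>G. finite G \<and> G \<subseteq> H \<and> H \<subseteq> frag.span G"
  using assms
proof (induction S arbitrary: H rule: finite_induct)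
  case empty
  then have "H \<subseteq> frag.span {}"
    by auto
  then show ?case
    by blast
next
  case (insert s S)
  let ?c = "\<lambda>u. Poly_Mapping.lookup u s"
  let ?H0 = "{u \<in> H. ?c u = 0}"
  have "frag.subspace ?H0"
    using insert.prems(1) by (auto simp: frag.subspace_def lookup_add)
  moreover have "Poly_Mapping.keys u \<subseteq> S" if "u \<in> ?H0" for u
    using that insert.prems(2)[of u] by (auto simp: in_keys_iff)
  ultimately obtain G where G: "finite G" "G \<subseteq> ?H0" "?H0 \<subseteq> frag.span G"
    using insert.IH[of ?H0] by auto
  show ?case
  proof (cases "\<exists>h\<in>H. ?c h \<noteq> 0")
    case False
    then show ?thesis
      using G by (intro exI[of _ G]) auto
  next
    case True
    then obtain h where h: "h \<in> H" "?c h \<noteq> 0"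
      and "\<And>u. u \<in> H \<and> ?c u \<noteq> 0 \<Longrightarrow> nat \<bar>?c h\<bar> \<le> nat \<bar>?c u\<bar>"
      using ex_has_least_nat[of "\<lambda>u. u \<in> H \<and> ?c u \<noteq> 0" _ "\<lambda>u. nat \<bar>?c u\<bar>"] by blast
    then have least: "\<bar>?c h\<bar> \<le> \<bar>?c u\<bar>" if "u \<in> H" "?c u \<noteq> 0" for u
      using that by force
    have "u \<in> frag.span (insert h G)" if u: "u \<in> H" for u
    proof -
      \<comment> \<open>Division with remainder: the coefficient of \<open>v\<close> at
        \<open>s\<close> is smaller in absolute value than that of \<open>h\<close>, hence 0 by
        minimality.\<close>
      define v where "v = u - frag_cmul (?c u div ?c h) h"
      have "v \<in> H"
        unfolding v_def using u h insert.prems(1) by (simp add: frag.subspace_diff frag.subspace_scale)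
      moreover have cv: "?c v = ?c u mod ?c h"
        unfolding v_def by (simp add: lookup_minus minus_div_mult_eq_mod)
      have "\<bar>?c v\<bar> < \<bar>?c h\<bar>"
        unfolding cv using h(2) by (rule abs_mod_less)
      then have "?c v = 0"
        using least[OF \<open>v \<in> H\<close>] by force
      ultimately show ?thesis
        using G(3) unfolding v_def frag.span_breakdown_eq by auto
    qed
    then show ?thesis
      using G h by (intro exI[of _ "insert h G"]) auto
  qed
qed

text \<open>The Euclidean algorithm: while the given elements satisfy a relation modulo \<open>span B\<close> with
  two nonzero coefficients, a change of generators makes its coefficients smaller, and a relation
  with a single coefficient is resolved by purity.\<close>

lemma frag_extend_independent:
  fixes K :: "('a \<Rightarrow>\<^sub>0 int) set" and g :: "'i \<Rightarrow> 'a \<Rightarrow>\<^sub>0 int"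
  assumes K: "frag.subspace K" and B: "frag.independent B" "B \<subseteq> K"
    and pure: "\<And>n v. \<lbrakk>n \<noteq> 0; v \<in> K; frag_cmul n v \<in> frag.span B\<rbrakk> \<Longrightarrow> v \<in> frag.span B"
    and "finite I" "g ` I \<subseteq> K"
  shows "\<exists>E. finite (E - B) \<and> B \<subseteq> E \<and> E \<subseteq> K \<and> frag.independent E \<and> g ` I \<subseteq> frag.span E"
  using assms(5,6)
proof (induction "card I" arbitrary: I g rule: less_induct)
  case less
  note outer = less.hyps
  let ?R = "\<lambda>g. \<exists>E. finite (E - B) \<and> B \<subseteq> E \<and> E \<subseteq> K \<and> frag.independent E \<and> g ` I \<subseteq> frag.span E"
  \<comment> \<open>Inner induction on the sum of the absolute values of the coefficients, with
    \<open>g\<close> varying; the outer one is on the number of generators.\<close>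
  have reduce: "?R g" if "g ` I \<subseteq> K" "(\<Sum>i\<in>I. frag_cmul (c i) (g i)) \<in> frag.span B" "p \<in> I" "c p \<noteq> 0"
    for c :: "'i \<Rightarrow> int" and g p
    using that
  proof (induct "nat (\<Sum>i\<in>I. \<bar>c i\<bar>)" arbitrary: c g p rule: less_induct)
    case (less c g p)
    note inner = less
    show ?case
    proof (cases "\<exists>q\<in>I. q \<noteq> p \<and> c q \<noteq> 0")
      case False
      then have "(\<Sum>i\<in>I. frag_cmul (c i) (g i)) = (\<Sum>i\<in>{p}. frag_cmul (c i) (g i))"
        using inner(4) \<open>finite I\<close> by (intro sum.mono_neutral_right) auto
      then have "g p \<in> frag.span B"
        using pure[of "c p" "g p"] inner by auto
      moreover obtain E where "finite (E - B)" "B \<subseteq> E" "E \<subseteq> K" "frag.independent E" "g ` (I - {p}) \<subseteq> frag.span E"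
        using outer[of "I - {p}" g] card_Diff1_less[OF \<open>finite I\<close> inner(4)] inner(2) \<open>finite I\<close>
        by blast
      ultimately have "g i \<in> frag.span E" if "i \<in> I" for i
        using frag.span_mono[of B E] that by (cases "i = p") auto
      then show ?thesis
        using \<open>finite (E - B)\<close> \<open>B \<subseteq> E\<close> \<open>E \<subseteq> K\<close> \<open>frag.independent E\<close> by blast
    next
      case True
      then obtain q0 where q0: "q0 \<in> I" "q0 \<noteq> p" "c q0 \<noteq> 0"
        by blast
      obtain p q where pq: "p \<in> I" "q \<in> I" "p \<noteq> q" "c p \<noteq> 0" "c q \<noteq> 0" "\<bar>c q\<bar> \<le> \<bar>c p\<bar>"
        using q0 inner(4,5) by (metis nle_le)
      \<comment> \<open>With this sign, \<open>s * c q\<close> has the sign of \<open>c p\<close>,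
        so subtracting it shrinks \<open>c p\<close>. Adding \<open>s\<close> times
        \<open>g p\<close> to \<open>g q\<close> compensates, and the value of the relation stays
        the same.\<close>
      define s where "s = sgn (c p) * sgn (c q)"
      define c' where "c' = c(p := c p - s * c q)"
      define g' where "g' = g(q := g q + frag_cmul s (g p))"
      have "(\<Sum>i\<in>I. f i) = f p + f q + (\<Sum>i\<in>I - {q, p}. f i)" for f :: "'i \<Rightarrow> 'z::comm_monoid_add"
        using pq \<open>finite I\<close>
          sum.remove[of I p f] sum.remove[of "I - {p}" q f] Diff_insert[of I q "{p}"]
        by (simp add: add.assoc)
      note split = this
      have "frag_cmul (c' p) (g' p) + frag_cmul (c' q) (g' q)
        = frag_cmul (c p) (g p) + frag_cmul (c q) (g q)"
        using pq(3) by (simp add: c'_def g'_def algebra_simps)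
      then have eq: "(\<Sum>i\<in>I. frag_cmul (c' i) (g' i)) = (\<Sum>i\<in>I. frag_cmul (c i) (g i))"
        unfolding split by (simp add: c'_def g'_def)
      have "\<bar>c' p\<bar> < \<bar>c p\<bar>"
        using pq by (auto simp: c'_def s_def sgn_if)
      then have lt: "(\<Sum>i\<in>I. \<bar>c' i\<bar>) < (\<Sum>i\<in>I. \<bar>c i\<bar>)"
        unfolding split using pq(3) by (simp add: c'_def)
      have g'K: "g' ` I \<subseteq> K"
        using inner(2) pq frag.subspace_add[OF K] frag.subspace_scale[OF K]
        by (simp add: g'_def image_subset_iff)
      have "nat (\<Sum>i\<in>I. \<bar>c' i\<bar>) < nat (\<Sum>i\<in>I. \<bar>c i\<bar>)"
        using lt by (subst nat_less_eq_zless) (simp_all add: sum_nonneg)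
      \<comment> \<open>The index with nonzero coefficient is now \<open>q\<close>, since
        \<open>c' p\<close> may have become 0.\<close>
      then obtain E where E: "B \<subseteq> E" "E \<subseteq> K" "frag.independent E" "g' ` I \<subseteq> frag.span E" "finite (E - B)"
        using inner(1)[of c' g' q] g'K pq eq inner(3) by (auto simp: c'_def)
      have "g i \<in> frag.span E" if "i \<in> I" for i
      proof (cases "i = q")
        case True
        then have "g i = g' q - frag_cmul s (g' p)"
          using pq by (simp add: g'_def)
        then show ?thesis
          using E(4) pq by (simp add: frag.span_diff frag.span_scale image_subset_iff)
      next
        case False
        then show ?thesis
          using E(4) that by (metis fun_upd_other g'_def image_subset_iff)
      qed
      then show ?thesis
        using E by blast
    qed
  qed
  show ?case
  proof (cases "\<exists>c p. (\<Sum>i\<in>I. frag_cmul (c i) (g i)) \<in> frag.span B \<and> p \<in> I \<and> c p \<noteq> 0")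
    case True
    then show ?thesis
      using reduce less.prems by blast
  next
    case False
    \<comment> \<open>Without nontrivial relations modulo \<open>frag.span B\<close>, adjoining the
      given elements to \<open>B\<close> already yields an independent set.\<close>
    then have free: "c p = 0" if "(\<Sum>i\<in>I. frag_cmul (c i) (g i)) \<in> frag.span B" "p \<in> I" for c p
      using that by blast
    have inj: "inj_on g I"
    proof (rule inj_onI, rule ccontr)
      fix p q assume pq: "p \<in> I" "q \<in> I" "g p = g q" "p \<noteq> q"
      let ?c = "\<lambda>i. if i = p then 1 else if i = q then - 1 else (0::int)"
      have "(\<Sum>i\<in>I. frag_cmul (?c i) (g i)) = (\<Sum>i\<in>{p, q}. frag_cmul (?c i) (g i))"
        using pq less.prems(1) by (intro sum.mono_neutral_right) auto
      also have "\<dots> = 0"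
        using pq by simp
      finally show False
        using free[of ?c p] pq(1) by (simp add: frag.span_zero)
    qed
    have "u v = 0" if t: "finite t" "t \<subseteq> B \<union> g ` I" "(\<Sum>v\<in>t. frag_cmul (u v) v) = 0" "v \<in> t" for t u v
    proof -
      \<comment> \<open>Extending \<open>u\<close> by 0 outside \<open>t\<close> allows the sum to
        run over all of \<open>I\<close>, where \<open>free\<close> applies.\<close>
      define w where "w = (\<lambda>v. if v \<in> t then u v else 0)"
      let ?S1 = "\<Sum>v\<in>t - g ` I. frag_cmul (u v) v"
      have "(\<Sum>v\<in>t. frag_cmul (u v) v) = ?S1 + (\<Sum>v\<in>t \<inter> g ` I. frag_cmul (u v) v)"
        using sum.Int_Diff[OF t(1), of "\<lambda>v. frag_cmul (u v) v" "g ` I"] by (simp add: add.commute)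
      also have "(\<Sum>v\<in>t \<inter> g ` I. frag_cmul (u v) v) = (\<Sum>v\<in>g ` I. frag_cmul (w v) v)"
        using less.prems(1) by (intro sum.mono_neutral_cong_left) (auto simp: w_def)
      also have "\<dots> = (\<Sum>i\<in>I. frag_cmul (w (g i)) (g i))"
        using inj by (simp add: sum.reindex)
      finally have eq: "?S1 + (\<Sum>i\<in>I. frag_cmul (w (g i)) (g i)) = 0"
        using t(3) by simp
      have "?S1 \<in> frag.span B"
        using t(2) by (intro frag.span_sum frag.span_scale frag.span_base) auto
      then have "(\<Sum>i\<in>I. frag_cmul (w (g i)) (g i)) \<in> frag.span B"
        using eq[unfolded add_eq_0_iff] frag.span_neg by (simp only:)
      then have w0: "w (g i) = 0" if "i \<in> I" for i
        using free[of "w \<circ> g"] that by simp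
      then have "?S1 = 0"
        using eq by (simp add: sum.neutral)
      then have "u v = 0" if "v \<in> t - g ` I" for v
        using frag.independentD[OF B(1), of "t - g ` I" u v] t(1,2) that by blast
      moreover have "u v = 0" if v: "v \<in> t \<inter> g ` I" for v
      proof -
        obtain i where "i \<in> I" "v = g i"
          using v by blast
        then show ?thesis
          using w0[of i] v by (simp add: w_def)
      qed
      ultimately show ?thesis
        using t(4) by blast
    qed
    then have "frag.independent (B \<union> g ` I)"
      unfolding frag.independent_explicit_module by blast
    then show ?thesis
      using B(2) less.prems frag.span_superset[of "B \<union> g ` I"]
      by (intro exI[of _ "B \<union> g ` I"]) (auto simp: Un_Diff)
  qed
qed

section \<open>Functoriality of tensor products and Tor\<close>

lemma free_map_0 [simp]: "free_map h 0 = 0"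
  and free_map_of [simp]: "free_map h (frag_of a) = frag_of (h a)"
  and free_map_add: "free_map h (x + y) = free_map h x + free_map h y"
  and free_map_diff: "free_map h (x - y) = free_map h x - free_map h y"
  and free_map_cmul: "free_map h (frag_cmul c x) = frag_cmul c (free_map h x)"
  by (simp_all add: free_map_def frag_extend_add frag_extend_diff frag_extend_cmul)

lemma module_hom_free_map: "module_hom frag_cmul frag_cmul (free_map h)"
  by (simp add: module_hom_iff frag.module_axioms free_map_add free_map_cmul)

lemma keys_free_map: "Poly_Mapping.keys (free_map h x) \<subseteq> h ` Poly_Mapping.keys x"
  using keys_frag_extend[of "frag_of \<circ> h" x] by (auto simp: free_map_def)

lemma keys_free_map_subset:
  "Poly_Mapping.keys x \<subseteq> S \<Longrightarrow> h ` S \<subseteq> T \<Longrightarrow> Poly_Mapping.keys (free_map h x) \<subseteq> T"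
  using keys_free_map[of h x] by (meson image_mono order_trans)

lemma free_map_cong: "(\<And>a. a \<in> Poly_Mapping.keys x \<Longrightarrow> g a = h a) \<Longrightarrow> free_map g x = free_map h x"
  unfolding free_map_def by (rule frag_extend_eq) simp

lemma free_map_free_map: "free_map g (free_map h x) = free_map (g \<circ> h) x"
  by (simp add: free_map_def frag_extend_compose comp_assoc)

lemma free_map_id [simp]: "free_map id x = x"
  using frag_expansion[of x] by (simp add: free_map_def)

text \<open>A map injective on \<open>S\<close> alone thus induces an injective map on the formal
  sums supported in \<open>S\<close>.\<close>

lemma free_map_inv_into:
  assumes "inj_on h S" "Poly_Mapping.keys x \<subseteq> S"
  shows "free_map (inv_into S h) (free_map h x) = x"
proof -
  have "free_map (inv_into S h) (free_map h x) = free_map id x"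
    unfolding free_map_free_map using assms by (intro free_map_cong) (auto simp: subsetD)
  then show ?thesis
    by simp
qed

lemma free_map_inv_into':
  assumes "Poly_Mapping.keys y \<subseteq> h ` S"
  shows "free_map h (free_map (inv_into S h) y) = y"
proof -
  have "free_map h (free_map (inv_into S h) y) = free_map id y"
    unfolding free_map_free_map using assms by (intro free_map_cong) (auto simp: f_inv_into_f subsetD)
  then show ?thesis
    by simp
qed

section \<open>Evaluation of formal sums and the two-term free resolution\<close>

context comm_group
begin

text \<open>The additional factors have exponent 0. Two formal sums can so be evaluated over a
  common index set, which gives additivity.\<close>

lemma free_eval_superset:
  assumes "finite T" "Poly_Mapping.keys x \<subseteq> T" "T \<subseteq> carrier G"
  shows "free_eval G x = (\<Otimes>a\<in>T. a [^] Poly_Mapping.lookup x a)"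
  unfolding free_eval_def using assms
  by (intro finprod_mono_neutral_cong_left) (auto simp: in_keys_iff)

lemma free_eval_of [simp]: "a \<in> carrier G \<Longrightarrow> free_eval G (frag_of a) = a"
  by (simp add: free_eval_def)

lemma free_eval_hom: "free_eval G \<in> hom (free_Abelian_group (carrier G)) G"
proof (rule homI)
  fix x y
  assume xy: "x \<in> carrier (free_Abelian_group (carrier G))" "y \<in> carrier (free_Abelian_group (carrier G))"
  let ?T = "Poly_Mapping.keys x \<union> Poly_Mapping.keys y"
  have T: "finite ?T" "?T \<subseteq> carrier G" "Poly_Mapping.keys (x + y) \<subseteq> ?T"
    using xy keys_add[of x y] by auto
  have "free_eval G (x + y) = (\<Otimes>a\<in>?T. a [^] Poly_Mapping.lookup x a \<otimes> a [^] Poly_Mapping.lookup y a)"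
    unfolding free_eval_superset[OF T(1,3,2)] using T(2)
    by (intro finprod_cong') (auto simp: lookup_add int_pow_mult)
  also have "\<dots> = free_eval G x \<otimes> free_eval G y"
    unfolding free_eval_superset[OF T(1) Un_upper1 T(2)] free_eval_superset[OF T(1) Un_upper2 T(2)]
    using T(2) by (intro finprod_multf) auto
  finally show "free_eval G (x \<otimes>\<^bsub>free_Abelian_group (carrier G)\<^esub> y) = free_eval G x \<otimes> free_eval G y"
    by simp
qed (auto simp: free_eval_def intro!: finprod_closed)

lemma group_hom_free_eval: "group_hom (free_Abelian_group (carrier G)) G (free_eval G)"
  by (simp add: group_hom_def group_hom_axioms_def free_eval_hom group_axioms)

lemma free_eval_closed: "Poly_Mapping.keys x \<subseteq> carrier G \<Longrightarrow> free_eval G x \<in> carrier G"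
  using group_hom.hom_closed[OF group_hom_free_eval, of x] by simp

lemma free_eval_0 [simp]: "free_eval G 0 = \<one>"
  using group_hom.hom_one[OF group_hom_free_eval] by simp

lemma free_eval_diff:
  assumes "Poly_Mapping.keys x \<subseteq> carrier G" "Poly_Mapping.keys y \<subseteq> carrier G"
  shows "free_eval G (x - y) = free_eval G x \<otimes> inv (free_eval G y)"
  using group_hom.hom_mult[OF group_hom_free_eval, of x "- y"]
    group_hom.hom_inv[OF group_hom_free_eval, of y] assms by (simp add: keys_minus)

text \<open>Naturality of evaluation: both sides are homomorphisms in \<open>x\<close> and agree on
  generators. This is why the induced map of free groups restricts to the kernels.\<close>

lemma free_eval_free_map:
  assumes "comm_group H" "h \<in> hom G H" "Poly_Mapping.keys x \<subseteq> carrier G"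
  shows "free_eval H (free_map h x) = h (free_eval G x)"
proof -
  interpret H: comm_group H by fact
  interpret h: group_hom G H h
    using assms(2) by unfold_locales
  show ?thesis
    using assms(3)
  proof (rule free_Abelian_group_induct)
    fix x y
    assume xy: "Poly_Mapping.keys x \<subseteq> carrier G" "Poly_Mapping.keys y \<subseteq> carrier G"
      "free_eval H (free_map h x) = h (free_eval G x)" "free_eval H (free_map h y) = h (free_eval G y)"
    have "Poly_Mapping.keys (free_map h z) \<subseteq> carrier H" if "Poly_Mapping.keys z \<subseteq> carrier G" for z
      using that by (rule keys_free_map_subset) auto
    with xy show "free_eval H (free_map h (x - y)) = h (free_eval G (x - y))"
      by (simp add: free_map_diff free_eval_diff H.free_eval_diff free_eval_closed)
  qed auto
qed

lemma group_resolution0: "group (resolution0 G)"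
  by (simp add: resolution0_def)

lemma group_resolution1: "group (resolution1 G)"
  unfolding resolution1_def
  by (rule group.subgroup_imp_group[OF group_resolution0])
    (unfold resolution0_def, rule group_hom.subgroup_kernel[OF group_hom_free_eval])

lemma resolution1_subspace: "frag.subspace (carrier (resolution1 G))"
proof (rule frag.subspaceI)
  interpret R: group "resolution1 G" by (rule group_resolution1)
  show "0 \<in> carrier (resolution1 G)"
    using R.one_closed by (simp add: resolution1_def resolution0_def)
  show add: "x + y \<in> carrier (resolution1 G)" if "x \<in> carrier (resolution1 G)" "y \<in> carrier (resolution1 G)" for x y
    using R.m_closed[OF that] by (simp add: resolution1_def resolution0_def)
  have "x - y \<in> carrier (resolution1 G)" if "x \<in> carrier (resolution1 G)" "y \<in> carrier (resolution1 G)" for x y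
    using that keys_diff[of x y]
    by (auto simp: resolution1_def resolution0_def kernel_def free_eval_diff)
  then show "frag_cmul c x \<in> carrier (resolution1 G)" if "x \<in> carrier (resolution1 G)" for c x
    using that \<open>0 \<in> carrier (resolution1 G)\<close>
    by (intro frag_closure_minus_cmul[where P = "\<lambda>x. x \<in> carrier (resolution1 G)"])
qed

end

lemma carrier_resolution0: "x \<in> carrier (resolution0 A) \<longleftrightarrow> Poly_Mapping.keys x \<subseteq> carrier A"
  by (simp add: resolution0_def)

lemma mult_resolution0 [simp]: "x \<otimes>\<^bsub>resolution0 A\<^esub> y = x + y"
  by (simp add: resolution0_def)

lemma carrier_resolution1:
  "x \<in> carrier (resolution1 A) \<longleftrightarrow> Poly_Mapping.keys x \<subseteq> carrier A \<and> free_eval A x = \<one>\<^bsub>A\<^esub>"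
  by (simp add: resolution1_def resolution0_def kernel_def)

lemma mult_resolution1 [simp]: "x \<otimes>\<^bsub>resolution1 A\<^esub> y = x + y"
  by (simp add: resolution1_def resolution0_def)

lemma free_map_hom_resolution0:
  assumes "f \<in> hom A A'"
  shows "free_map f \<in> hom (resolution0 A) (resolution0 A')"
  using assms
  by (intro homI) (auto simp: carrier_resolution0 free_map_add hom_def dest!: subsetD[OF keys_free_map])

lemma free_map_hom_resolution1:
  assumes "comm_group A" "comm_group A'" "f \<in> hom A A'"
  shows "free_map f \<in> hom (resolution1 A) (resolution1 A')"
proof (rule homI)
  interpret f: group_hom A A' f
    using assms by (simp add: group_hom_def group_hom_axioms_def comm_group_def)
  fix x assume "x \<in> carrier (resolution1 A)"
  then show "free_map f x \<in> carrier (resolution1 A')"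
    using keys_free_map_subset[of x "carrier A" f "carrier A'"] f.hom_closed comm_group.free_eval_free_map[OF assms, of x]
    by (simp add: carrier_resolution1 image_subset_iff)
qed (simp add: free_map_add)

section \<open>Tensor relations as an integral span\<close>

definition bilinear_relators ::
    "('a, 'm) monoid_scheme \<Rightarrow> ('b, 'n) monoid_scheme \<Rightarrow> ('a \<times> 'b \<Rightarrow>\<^sub>0 int) set" where
  "bilinear_relators A B =
     {frag_of (a \<otimes>\<^bsub>A\<^esub> a', b) - frag_of (a, b) - frag_of (a', b) | a a' b.
         a \<in> carrier A \<and> a' \<in> carrier A \<and> b \<in> carrier B} \<union>
     {frag_of (a, b \<otimes>\<^bsub>B\<^esub> b') - frag_of (a, b) - frag_of (a, b') | a b b'.
         a \<in> carrier A \<and> b \<in> carrier B \<and> b' \<in> carrier B}"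

text \<open>A subgroup is closed under integer multiples by repeated subtraction, so generated
  subgroup and integral span coincide. Inductions over spans then apply to tensor relations.\<close>

lemma generate_free_Abelian_group_eq_span:
  assumes "X \<subseteq> carrier (free_Abelian_group S)"
  shows "generate (free_Abelian_group S) X = frag.span X"
proof
  show "generate (free_Abelian_group S) X \<subseteq> frag.span X"
  proof
    fix x assume "x \<in> generate (free_Abelian_group S) X"
    then show "x \<in> frag.span X"
      using assms by induction (auto simp: frag.span_zero frag.span_base frag.span_add frag.span_neg subset_iff)
  qed
  interpret subgroup "generate (free_Abelian_group S) X" "free_Abelian_group S"
    using assms by (intro group.generate_is_subgroup) auto
  have "x - y \<in> generate (free_Abelian_group S) X"
    if "x \<in> generate (free_Abelian_group S) X" "y \<in> generate (free_Abelian_group S) X" for x y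
    using m_closed[OF that(1) m_inv_closed[OF that(2)]] mem_carrier[OF that(2)] by simp
  then have "frag.subspace (generate (free_Abelian_group S) X)"
    using one_closed m_closed
    by (intro frag.subspaceI frag_closure_minus_cmul[where P = "\<lambda>x. x \<in> generate (free_Abelian_group S) X"]) auto
  then show "frag.span X \<subseteq> generate (free_Abelian_group S) X"
    by (intro frag.span_minimal) (auto intro: generate.incl)
qed

lemma tensor_relations_eq_span:
  assumes "group A" "group B"
  shows "tensor_relations A B = frag.span (bilinear_relators A B)"
proof -
  interpret A: group A by fact
  interpret B: group B by fact
  have "bilinear_relators A B \<subseteq> carrier (free_Abelian_group (carrier A \<times> carrier B))"
    unfolding bilinear_relators_def by (auto dest!: subsetD[OF keys_diff])
  then show ?thesis
    unfolding tensor_relations_def bilinear_relators_def[symmetric]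
    by (rule generate_free_Abelian_group_eq_span)
qed

lemma tensor_relations_subspace:
  assumes "group A" "group B"
  shows "frag.subspace (tensor_relations A B)"
  by (simp add: tensor_relations_eq_span[OF assms])

lemma tensor_relations_left:
  assumes "group A" "group B" "a \<in> carrier A" "a' \<in> carrier A" "b \<in> carrier B"
  shows "frag_of (a \<otimes>\<^bsub>A\<^esub> a', b) - frag_of (a, b) - frag_of (a', b) \<in> tensor_relations A B"
  unfolding tensor_relations_eq_span[OF assms(1,2)]
  by (rule frag.span_base) (use assms in \<open>auto simp: bilinear_relators_def\<close>)

lemma tensor_relations_right:
  assumes "group A" "group B" "a \<in> carrier A" "b \<in> carrier B" "b' \<in> carrier B"
  shows "frag_of (a, b \<otimes>\<^bsub>B\<^esub> b') - frag_of (a, b) - frag_of (a, b') \<in> tensor_relations A B"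
  unfolding tensor_relations_eq_span[OF assms(1,2)]
  by (rule frag.span_base) (use assms in \<open>auto simp: bilinear_relators_def\<close>)

text \<open>The induced map is linear and sends each bilinear relator to a bilinear relator.\<close>

lemma free_map_tensor_relations:
  assumes "group A" "group B" "group A'" "group B'" "f \<in> hom A A'" "g \<in> hom B B'"
    and "r \<in> tensor_relations A B"
  shows "free_map (map_prod f g) r \<in> tensor_relations A' B'"
proof -
  have "free_map (map_prod f g) ` bilinear_relators A B \<subseteq> tensor_relations A' B'"
    using assms(5,6) tensor_relations_left[OF assms(3,4)] tensor_relations_right[OF assms(3,4)]
    by (auto simp: bilinear_relators_def free_map_diff hom_def Pi_iff)
  then have "frag.span (free_map (map_prod f g) ` bilinear_relators A B) \<subseteq> tensor_relations A' B'"
    using tensor_relations_subspace[OF assms(3,4)] by (rule frag.span_minimal)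
  then show ?thesis
    using assms(7) unfolding tensor_relations_eq_span[OF assms(1,2)]
      module_hom.span_image[OF module_hom_free_map] by blast
qed

section \<open>Representatives of elements of tensor products and of Tor\<close>

abbreviation tensor_class ::
    "('a, 'm) monoid_scheme \<Rightarrow> ('b, 'n) monoid_scheme \<Rightarrow> ('a \<times> 'b \<Rightarrow>\<^sub>0 int) \<Rightarrow> ('a \<times> 'b \<Rightarrow>\<^sub>0 int) set" where
  "tensor_class A B x \<equiv> tensor_relations A B #>\<^bsub>free_Abelian_group (carrier A \<times> carrier B)\<^esub> x"

lemma tensor_class_eq: "tensor_class A B x = (\<lambda>r. r + x) ` tensor_relations A B"
  by (auto simp: r_coset_def)

lemma tensor_class_eq_iff:
  assumes "group A" "group B"
  shows "tensor_class A B x = tensor_class A B y \<longleftrightarrow> x - y \<in> tensor_relations A B"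
proof
  note R = tensor_relations_subspace[OF assms]
  have "x \<in> tensor_class A B x"
    using frag.subspace_0[OF R] by (force simp: tensor_class_eq)
  then show "x - y \<in> tensor_relations A B" if "tensor_class A B x = tensor_class A B y"
    using that by (auto simp: tensor_class_eq)
  have *: "tensor_class A B x \<subseteq> tensor_class A B y" if "x - y \<in> tensor_relations A B" for x y
  proof
    fix z assume "z \<in> tensor_class A B x"
    then obtain r where "r \<in> tensor_relations A B" "z = r + x"
      by (auto simp: tensor_class_eq)
    then have "z = (r + (x - y)) + y" "r + (x - y) \<in> tensor_relations A B"
      using frag.subspace_add[OF R] that by auto
    then show "z \<in> tensor_class A B y"
      unfolding tensor_class_eq by (rule image_eqI)
  qed
  show "tensor_class A B x = tensor_class A B y" if "x - y \<in> tensor_relations A B"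
    using *[OF that] *[of y x] frag.subspace_neg[OF R that] by simp
qed

lemma one_tensor: "\<one>\<^bsub>tensor A B\<^esub> = tensor_class A B 0"
  by (auto simp: tensor_def tensor_class_eq)

lemma carrier_tensor:
  "carrier (tensor A B) = tensor_class A B ` {x. Poly_Mapping.keys x \<subseteq> carrier A \<times> carrier B}"
  by (auto simp: tensor_def carrier_FactGroup)

lemma mult_tensor_class:
  assumes "group A" "group B"
  shows "tensor_class A B x \<otimes>\<^bsub>tensor A B\<^esub> tensor_class A B y = tensor_class A B (x + y)"
proof -
  note R = tensor_relations_subspace[OF assms]
  have "tensor_class A B x \<otimes>\<^bsub>tensor A B\<^esub> tensor_class A B y
    = {(r + x) + (s + y) | r s. r \<in> tensor_relations A B \<and> s \<in> tensor_relations A B}"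
    by (auto simp: tensor_def set_mult_def tensor_class_eq)
  also have "\<dots> = tensor_class A B (x + y)"
  proof (intro equalityI subsetI)
    fix z assume "z \<in> {(r + x) + (s + y) | r s. r \<in> tensor_relations A B \<and> s \<in> tensor_relations A B}"
    then obtain r s where "r \<in> tensor_relations A B" "s \<in> tensor_relations A B" "z = (r + s) + (x + y)"
      by (auto simp: algebra_simps)
    then show "z \<in> tensor_class A B (x + y)"
      using frag.subspace_add[OF R] by (auto simp: tensor_class_eq)
  next
    fix z assume "z \<in> tensor_class A B (x + y)"
    then obtain r where "r \<in> tensor_relations A B" "z = (r + x) + (0 + y)"
      by (auto simp: tensor_class_eq algebra_simps)
    then show "z \<in> {(r + x) + (s + y) | r s. r \<in> tensor_relations A B \<and> s \<in> tensor_relations A B}"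
      using frag.subspace_0[OF R] by blast
  qed
  finally show ?thesis .
qed

text \<open>All representatives of a coset have images in one coset, so the set inside
  \<open>the_elem\<close> is a singleton.\<close>

lemma tensor_map_class:
  assumes "group A" "group B" "group A'" "group B'" "f \<in> hom A A'" "g \<in> hom B B'"
  shows "tensor_map A' B' f g (tensor_class A B x) = tensor_class A' B' (free_map (map_prod f g) x)"
proof -
  have "tensor_class A' B' (free_map (map_prod f g) (r + x)) = tensor_class A' B' (free_map (map_prod f g) x)"
    if "r \<in> tensor_relations A B" for r
    using free_map_tensor_relations[OF assms that]
    by (simp add: tensor_class_eq_iff[OF assms(3,4)] free_map_add)
  moreover have "tensor_relations A B \<noteq> {}"
    using frag.subspace_0[OF tensor_relations_subspace[OF assms(1,2)]] by blast
  ultimately have "(\<lambda>x. tensor_class A' B' (free_map (map_prod f g) x)) ` tensor_class A B x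
    = {tensor_class A' B' (free_map (map_prod f g) x)}"
    unfolding tensor_class_eq[of A B] by auto
  then show ?thesis
    unfolding tensor_map_def by simp
qed

text \<open>The inclusion of \<open>resolution1 A\<close> into \<open>resolution0 A\<close> leaves
  formal sums unchanged; lying in the kernel means being a relation over the larger group.\<close>

lemma carrier_tor:
  assumes "comm_group A" "group B"
  shows "carrier (tor A B) = tensor_class (resolution1 A) B `
    {x. Poly_Mapping.keys x \<subseteq> carrier (resolution1 A) \<times> carrier B \<and> x \<in> tensor_relations (resolution0 A) B}"
proof -
  note gr = comm_group.group_resolution1[OF assms(1)] assms(2)
    comm_group.group_resolution0[OF assms(1)] assms(2)
  have "id \<in> hom (resolution1 A) (resolution0 A)" "id \<in> hom B B"
    by (auto simp: hom_def carrier_resolution0 carrier_resolution1)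
  then have "tensor_map (resolution0 A) B id id (tensor_class (resolution1 A) B x)
      = \<one>\<^bsub>tensor (resolution0 A) B\<^esub> \<longleftrightarrow> x \<in> tensor_relations (resolution0 A) B" for x
    by (simp add: tensor_map_class[OF gr] map_prod.id one_tensor tensor_class_eq_iff[OF gr(3,4)])
  then show ?thesis
    by (auto simp: tor_def kernel_def carrier_tensor)
qed

lemma mult_tor_class:
  assumes "comm_group A" "group B"
  shows "tensor_class (resolution1 A) B x \<otimes>\<^bsub>tor A B\<^esub> tensor_class (resolution1 A) B y
    = tensor_class (resolution1 A) B (x + y)"
  using mult_tensor_class[OF comm_group.group_resolution1[OF assms(1)] assms(2)] by (simp add: tor_def)

lemma tor_map_class:
  assumes "comm_group A" "group B" "comm_group A'" "group B'" "f \<in> hom A A'" "g \<in> hom B B'"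
  shows "tor_map A' B' f g (tensor_class (resolution1 A) B x)
    = tensor_class (resolution1 A') B' (free_map (map_prod (free_map f) g) x)"
  unfolding tor_map_def
  by (rule tensor_map_class)
    (use assms in \<open>simp_all add: comm_group.group_resolution1 free_map_hom_resolution1\<close>)

lemma tor_map_hom:
  assumes "comm_group A" "group B" "comm_group A'" "group B'" "f \<in> hom A A'" "g \<in> hom B B'"
  shows "tor_map A' B' f g \<in> hom (tor A B) (tor A' B')"
proof (rule homI)
  fix X assume "X \<in> carrier (tor A B)"
  then obtain x where x: "X = tensor_class (resolution1 A) B x"
      "Poly_Mapping.keys x \<subseteq> carrier (resolution1 A) \<times> carrier B" "x \<in> tensor_relations (resolution0 A) B"
    unfolding carrier_tor[OF assms(1,2)] by blast
  let ?y = "free_map (map_prod (free_map f) g) x"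
  have "?y \<in> tensor_relations (resolution0 A') B'"
    using assms x(3)
    by (intro free_map_tensor_relations[of "resolution0 A" B])
      (simp_all add: comm_group.group_resolution0 free_map_hom_resolution0)
  moreover have "Poly_Mapping.keys ?y \<subseteq> carrier (resolution1 A') \<times> carrier B'"
    using x(2) by (rule keys_free_map_subset)
      (use free_map_hom_resolution1[OF assms(1,3,5)] assms(6) in \<open>auto simp: hom_def\<close>)
  ultimately show "tor_map A' B' f g X \<in> carrier (tor A' B')"
    unfolding x(1) tor_map_class[OF assms] carrier_tor[OF assms(3,4)] by blast
next
  fix X Y assume "X \<in> carrier (tor A B)" "Y \<in> carrier (tor A B)"
  then obtain x y where "X = tensor_class (resolution1 A) B x" "Y = tensor_class (resolution1 A) B y"
    unfolding carrier_tor[OF assms(1,2)] by blast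
  then show "tor_map A' B' f g (X \<otimes>\<^bsub>tor A B\<^esub> Y) = tor_map A' B' f g X \<otimes>\<^bsub>tor A' B'\<^esub> tor_map A' B' f g Y"
    by (simp add: mult_tor_class[OF assms(1,2)] mult_tor_class[OF assms(3,4)] tor_map_class[OF assms]
        free_map_add)
qed

section \<open>Vanishing of tensors\<close>

text \<open>Bilinearity moves integer coefficients to the right factor, where they are collected for
  each \<open>k\<close>. In the proof, \<open>D\<close> is the set of formal sums that have such a
  form; it is closed under differences and contains all pairs \<open>(u, b)\<close> with
  \<open>u\<close> in the span.\<close>

lemma tensor_normal_form:
  assumes N: "group N" "\<And>x y. x \<otimes>\<^bsub>N\<^esub> y = x + y" "frag.subspace (carrier N)"
    and B: "group B"
    and E: "finite E" "E \<subseteq> carrier N"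
    and X: "Poly_Mapping.keys X \<subseteq> frag.span E \<times> carrier B"
  shows "\<exists>\<beta>. \<beta> ` E \<subseteq> carrier B \<and> X - (\<Sum>k\<in>E. frag_of (k, \<beta> k)) \<in> tensor_relations N B"
proof -
  interpret B: group B by fact
  let ?R = "tensor_relations N B"
  define D where "D = {X. \<exists>\<beta>. \<beta> ` E \<subseteq> carrier B \<and> X - (\<Sum>k\<in>E. frag_of (k, \<beta> k)) \<in> ?R}"
  note R = tensor_relations_subspace[OF N(1) B]
  note left = tensor_relations_left[OF N(1) B, unfolded N(2)]
  note right = tensor_relations_right[OF N(1) B]
  \<comment> \<open>The right relator for the product of the unit with itself collapses to the
    negative of this generator.\<close>
  have one: "frag_of (k, \<one>\<^bsub>B\<^esub>) \<in> ?R" if "k \<in> carrier N" for k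
    using frag.subspace_neg[OF R right[OF that B.one_closed B.one_closed]] by simp
  have sum_one: "(\<Sum>k\<in>F. frag_of (k, \<one>\<^bsub>B\<^esub>)) \<in> ?R" if "F \<subseteq> E" for F
    using one E(2) that by (intro frag.subspace_sum[OF R]) auto
  have R_D: "?R \<subseteq> D"
    unfolding D_def using sum_one[of E] frag.subspace_diff[OF R]
    by (auto intro!: exI[of _ "\<lambda>_. \<one>\<^bsub>B\<^esub>"])
  have D_diff: "X - Y \<in> D" if XY: "X \<in> D" "Y \<in> D" for X Y
  proof -
    obtain \<beta> where \<beta>: "\<beta> ` E \<subseteq> carrier B" "X - (\<Sum>k\<in>E. frag_of (k, \<beta> k)) \<in> ?R"
      using XY(1) unfolding D_def by blast
    obtain \<gamma> where \<gamma>: "\<gamma> ` E \<subseteq> carrier B" "Y - (\<Sum>k\<in>E. frag_of (k, \<gamma> k)) \<in> ?R"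
      using XY(2) unfolding D_def by blast
    \<comment> \<open>In additive terms \<open>\<delta> = \<beta> - \<gamma>\<close>; the relators
      for \<open>\<beta> k = \<delta> k + \<gamma> k\<close> carry out the subtraction.\<close>
    define \<delta> where "\<delta> k = \<beta> k \<otimes>\<^bsub>B\<^esub> inv\<^bsub>B\<^esub> (\<gamma> k)" for k
    have "frag_of (k, \<beta> k) - frag_of (k, \<delta> k) - frag_of (k, \<gamma> k) \<in> ?R" if "k \<in> E" for k
    proof -
      have "\<beta> k \<in> carrier B" "\<gamma> k \<in> carrier B" "k \<in> carrier N"
        using that \<beta>(1) \<gamma>(1) E(2) by auto
      then show ?thesis
        using right[of k "\<delta> k" "\<gamma> k"] by (simp add: \<delta>_def B.m_assoc)
    qed
    then have "(\<Sum>k\<in>E. frag_of (k, \<beta> k) - frag_of (k, \<delta> k) - frag_of (k, \<gamma> k)) \<in> ?R"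
      by (rule frag.subspace_sum[OF R])
    then have "(X - (\<Sum>k\<in>E. frag_of (k, \<beta> k))) - (Y - (\<Sum>k\<in>E. frag_of (k, \<gamma> k)))
      + (\<Sum>k\<in>E. frag_of (k, \<beta> k) - frag_of (k, \<delta> k) - frag_of (k, \<gamma> k)) \<in> ?R"
      by (rule frag.subspace_add[OF R frag.subspace_diff[OF R \<beta>(2) \<gamma>(2)]])
    then have "(X - Y) - (\<Sum>k\<in>E. frag_of (k, \<delta> k)) \<in> ?R"
      by (simp add: sum_subtractf sum.distrib algebra_simps)
    moreover have "\<delta> ` E \<subseteq> carrier B"
      using \<beta>(1) \<gamma>(1) by (simp add: \<delta>_def image_subset_iff)
    ultimately show ?thesis
      unfolding D_def by blast
  qed
  have D_0: "0 \<in> D"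
    using R_D frag.subspace_0[OF R] by blast
  have D_add: "X + Y \<in> D" if "X \<in> D" "Y \<in> D" for X Y
    using D_diff[OF that(1) D_diff[OF D_0 that(2)]] by simp
  have gen: "frag_of (k, b) \<in> D" if k: "k \<in> E" and b: "b \<in> carrier B" for k b
  proof -
    let ?\<beta> = "(\<lambda>_. \<one>\<^bsub>B\<^esub>)(k := b)"
    have "(\<Sum>k\<in>E. frag_of (k, ?\<beta> k)) = frag_of (k, b) + (\<Sum>k\<in>E - {k}. frag_of (k, \<one>\<^bsub>B\<^esub>))"
      using k E(1) by (simp add: sum.remove)
    then have "frag_of (k, b) - (\<Sum>k\<in>E. frag_of (k, ?\<beta> k)) \<in> ?R"
      using frag.subspace_neg[OF R sum_one[of "E - {k}"]] by simp
    moreover have "?\<beta> ` E \<subseteq> carrier B"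
      using b by auto
    ultimately show ?thesis
      unfolding D_def by blast
  qed
  have add: "frag_of (u + v, b) \<in> D"
    if "frag_of (u, b) \<in> D" "frag_of (v, b) \<in> D" "u \<in> carrier N" "v \<in> carrier N" "b \<in> carrier B" for u v b
    using D_add[OF D_add[OF subsetD[OF R_D left[OF that(3-5)]] that(1)] that(2)] by simp
  have zero: "frag_of (0, b) \<in> D" if "b \<in> carrier B" for b
    using frag.subspace_neg[OF R left[OF frag.subspace_0[OF N(3)] frag.subspace_0[OF N(3)] that]] R_D
    by auto
  have neg: "frag_of (- u, b) \<in> D"
    if "frag_of (u, b) \<in> D" "u \<in> carrier N" "b \<in> carrier B" for u b
  proof -
    have "- u \<in> carrier N"
      using frag.subspace_neg[OF N(3) that(2)] .
    then have "frag_of (0, b) - frag_of (u, b) - frag_of (- u, b) \<in> D"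
      using left[OF that(2) _ that(3), of "- u"] R_D by auto
    then have "(frag_of (0, b) - frag_of (u, b)) - (frag_of (0, b) - frag_of (u, b) - frag_of (- u, b)) \<in> D"
      by (rule D_diff[OF D_diff[OF zero[OF that(3)] that(1)]])
    then show ?thesis
      by simp
  qed
  have scale: "frag_of (frag_cmul c u, b) \<in> D"
    if "frag_of (u, b) \<in> D" "u \<in> carrier N" "b \<in> carrier B" for c u b
  \<comment> \<open>Membership in \<open>carrier N\<close> is part of the invariant because the left
    relators require it.\<close>
  proof (rule frag_closure_minus_cmul[where P = "\<lambda>u. frag_of (u, b) \<in> D \<and> u \<in> carrier N", THEN conjunct1])
    show "frag_of (x - y, b) \<in> D \<and> x - y \<in> carrier N"
      if "frag_of (x, b) \<in> D \<and> x \<in> carrier N" "frag_of (y, b) \<in> D \<and> y \<in> carrier N" for x y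
      using add[of x b "- y"] neg[of y b] that \<open>b \<in> carrier B\<close> frag.subspace_diff[OF N(3)] frag.subspace_neg[OF N(3)]
      by simp
  qed (use that zero frag.subspace_0[OF N(3)] in auto)
  have "frag_of (u, b) \<in> D \<and> u \<in> carrier N" if "u \<in> frag.span E" "b \<in> carrier B" for u b
    using that(1)
  proof (induction rule: frag.span_induct_alt)
    case base
    then show ?case
      using zero that(2) frag.subspace_0[OF N(3)] by simp
  next
    case (step c x y)
    then show ?case
      using E(2) gen[OF _ that(2)] scale add that(2) frag.subspace_add[OF N(3)] frag.subspace_scale[OF N(3)]
      by (meson subsetD)
  qed
  then have "X \<in> D"
    using X D_0 D_diff by (intro free_Abelian_group_induct[OF X, of "\<lambda>x. x \<in> D"]) auto
  then show ?thesis
    unfolding D_def by blast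
qed

text \<open>Contracting the left factor with \<open>l\<close> sends right relators to multiples of
  elements of the kernel of evaluation, and left relators to 0 where \<open>l\<close> is additive.
  As \<open>Y\<close> involves finitely many relators, additivity of \<open>l\<close> on finitely
  many pairs \<open>\<Phi>\<close> suffices; \<open>l\<close> may fail to be a homomorphism on
  \<open>N\<close>.\<close>

lemma tensor_relations_functional:
  assumes "group N" "comm_group B" "Y \<in> tensor_relations N B"
  shows "\<exists>\<Phi>. finite \<Phi> \<and> \<Phi> \<subseteq> carrier N \<times> carrier N \<and>
    (\<forall>l::_ \<Rightarrow> int. (\<forall>(a, a')\<in>\<Phi>. l (a \<otimes>\<^bsub>N\<^esub> a') = l a + l a') \<longrightarrow>
      frag_extend (\<lambda>(u, b). frag_cmul (l u) (frag_of b)) Y \<in> carrier (resolution1 B))"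
proof -
  interpret B: comm_group B by fact
  note K = B.resolution1_subspace
  let ?W = "\<lambda>l. frag_extend (\<lambda>(u, b). frag_cmul (l u) (frag_of b))"
  have "Y \<in> frag.span (bilinear_relators N B)"
    using assms(3) tensor_relations_eq_span[OF assms(1) B.group_axioms] by simp
  then show ?thesis
  proof (induction rule: frag.span_induct_alt)
    case base
    then show ?case
      using frag.subspace_0[OF K] by (intro exI[of _ "{}"]) auto
  next
    case (step c x Y)
    then obtain \<Phi> where \<Phi>: "finite \<Phi>" "\<Phi> \<subseteq> carrier N \<times> carrier N"
      "\<And>l. (\<forall>(a, a')\<in>\<Phi>. l (a \<otimes>\<^bsub>N\<^esub> a') = l a + l a') \<Longrightarrow> ?W l Y \<in> carrier (resolution1 B)"
      by blast
    from step(1) consider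
        (left) a a' b where "x = frag_of (a \<otimes>\<^bsub>N\<^esub> a', b) - frag_of (a, b) - frag_of (a', b)"
          "a \<in> carrier N" "a' \<in> carrier N" "b \<in> carrier B"
      | (right) a b b' where "x = frag_of (a, b \<otimes>\<^bsub>B\<^esub> b') - frag_of (a, b) - frag_of (a, b')"
          "a \<in> carrier N" "b \<in> carrier B" "b' \<in> carrier B"
      unfolding bilinear_relators_def by blast
    then show ?case
    proof cases
      case left
      have "?W l (frag_cmul c x + Y) \<in> carrier (resolution1 B)"
        if l: "\<forall>(a, a')\<in>insert (a, a') \<Phi>. l (a \<otimes>\<^bsub>N\<^esub> a') = l a + l a'" for l
      proof -
        have "?W l x = 0"
          using l by (simp add: left(1) frag_extend_diff frag_cmul_distrib)
        then show ?thesis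
          using \<Phi>(3)[of l] l by (simp add: frag_extend_add frag_extend_cmul)
      qed
      then show ?thesis
        using \<Phi>(1,2) left by (intro exI[of _ "insert (a, a') \<Phi>"]) auto
    next
      case right
      let ?r = "frag_of (b \<otimes>\<^bsub>B\<^esub> b') - frag_of b - frag_of b'"
      have keys: "Poly_Mapping.keys (frag_of (b \<otimes>\<^bsub>B\<^esub> b') - frag_of b) \<subseteq> carrier B"
        using keys_diff[of "frag_of (b \<otimes>\<^bsub>B\<^esub> b')" "frag_of b"] right by auto
      then have "free_eval B ?r = \<one>\<^bsub>B\<^esub>"
        using right(3,4) by (simp add: B.free_eval_diff B.m_comm[of b b'] B.m_assoc)
      moreover have "Poly_Mapping.keys ?r \<subseteq> carrier B"
        using keys keys_diff[of "frag_of (b \<otimes>\<^bsub>B\<^esub> b') - frag_of b" "frag_of b'"] right by auto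
      ultimately have r: "?r \<in> carrier (resolution1 B)"
        by (simp add: carrier_resolution1)
      have "?W l (frag_cmul c x + Y) \<in> carrier (resolution1 B)"
        if l: "\<forall>(a, a')\<in>\<Phi>. l (a \<otimes>\<^bsub>N\<^esub> a') = l a + l a'" for l
      proof -
        have "?W l x = frag_cmul (l a) ?r"
          by (simp add: right(1) frag_extend_diff frag.scale_right_diff_distrib)
        then show ?thesis
          using \<Phi>(3)[of l] l r
          by (simp add: frag_extend_add frag_extend_cmul frag.subspace_add[OF K] frag.subspace_scale[OF K] del: frag_cmul_cmul)
      qed
      then show ?thesis
        using \<Phi>(1,2) by blast
    qed
  qed
qed

text \<open>By purity, \<open>E\<close> extends to an independent set \<open>E'\<close> whose span
  contains the components of all pairs in \<open>\<Phi>\<close>. Contraction with the coordinate at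
  \<open>k\<close> turns the relation into the single generator \<open>\<beta> k\<close>, which must
  then evaluate to the unit.\<close>

lemma tensor_pure_independent:
  assumes N: "group N" "\<And>x y. x \<otimes>\<^bsub>N\<^esub> y = x + y" "frag.subspace (carrier N)"
    and B: "comm_group B"
    and E: "finite E" "E \<subseteq> carrier N" "frag.independent E"
    and pure: "\<And>n v. \<lbrakk>n \<noteq> 0; v \<in> carrier N; frag_cmul n v \<in> frag.span E\<rbrakk> \<Longrightarrow> v \<in> frag.span E"
    and rel: "(\<Sum>k\<in>E. frag_of (k, \<beta> k)) \<in> tensor_relations N B"
    and k: "k \<in> E" "\<beta> k \<in> carrier B"
  shows "\<beta> k = \<one>\<^bsub>B\<^esub>"
proof -
  interpret B: comm_group B by fact
  obtain \<Phi> where \<Phi>: "finite \<Phi>" "\<Phi> \<subseteq> carrier N \<times> carrier N"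
    and ev: "\<And>l::_ \<Rightarrow> int. (\<forall>(a, a')\<in>\<Phi>. l (a + a') = l a + l a') \<Longrightarrow>
      frag_extend (\<lambda>(u, b). frag_cmul (l u) (frag_of b)) (\<Sum>k\<in>E. frag_of (k, \<beta> k)) \<in> carrier (resolution1 B)"
    using tensor_relations_functional[OF N(1) B rel] unfolding N(2) by blast
  have "\<exists>E'. finite (E' - E) \<and> E \<subseteq> E' \<and> E' \<subseteq> carrier N \<and> frag.independent E' \<and>
      id ` (fst ` \<Phi> \<union> snd ` \<Phi>) \<subseteq> frag.span E'"
    by (rule frag_extend_independent[OF N(3) E(3,2)]) (use pure \<Phi> in auto)
  then obtain E' where E': "E \<subseteq> E'" "frag.independent E'" "id ` (fst ` \<Phi> \<union> snd ` \<Phi>) \<subseteq> frag.span E'"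
    by blast
  \<comment> \<open>Outside the span of \<open>E'\<close> this coordinate has the default value 0;
    it is additive on the span, which contains all components of \<open>\<Phi>\<close>.\<close>
  let ?l = "\<lambda>u. frag.representation E' u k"
  have "\<forall>(a, a')\<in>\<Phi>. ?l (a + a') = ?l a + ?l a'"
  proof (clarify)
    fix a a' assume "(a, a') \<in> \<Phi>"
    then have "a \<in> frag.span E'" "a' \<in> frag.span E'"
      using E'(3) by (auto simp: image_subset_iff)
    then show "?l (a + a') = ?l a + ?l a'"
      by (simp add: frag.representation_add[OF E'(2)])
  qed
  then have "frag_extend (\<lambda>(u, b). frag_cmul (?l u) (frag_of b)) (\<Sum>k\<in>E. frag_of (k, \<beta> k)) \<in> carrier (resolution1 B)"
    by (rule ev)
  also have "frag_extend (\<lambda>(u, b). frag_cmul (?l u) (frag_of b)) (\<Sum>k\<in>E. frag_of (k, \<beta> k))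
    = (\<Sum>k'\<in>E. frag_cmul (?l k') (frag_of (\<beta> k')))"
    by (simp add: frag_extend_sum[OF E(1)])
  also have "\<dots> = (\<Sum>k'\<in>E. if k' = k then frag_of (\<beta> k) else 0)"
    using E'(1) by (intro sum.cong refl) (auto simp: frag.representation_basis[OF E'(2)] subset_iff)
  also have "\<dots> = frag_of (\<beta> k)"
    using E(1) k(1) by simp
  finally show ?thesis
    using k(2) by (simp add: carrier_resolution1)
qed

text \<open>This set is the torsion subgroup of the subgroup generated by \<open>S\<close>,
  described by lifts to formal sums. The lifts form a finitely generated group, and the coefficients
  of a lift matter only modulo the multiple that kills each generator.\<close>

lemma (in comm_group) finite_torsion:
  assumes S: "finite S" "S \<subseteq> carrier G"
  shows "finite (free_eval G ` {u. Poly_Mapping.keys u \<subseteq> S \<and> (\<exists>n. n \<noteq> 0 \<and> frag_cmul n u \<in> carrier (resolution1 G))})"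
    (is "finite (free_eval G ` ?P)")
proof -
  note K = resolution1_subspace
  have subP: "frag.subspace ?P"
  proof (rule frag.subspaceI)
    show "0 \<in> ?P"
      using frag.subspace_0[OF K] by (auto intro!: exI[of _ 1])
    show "x + y \<in> ?P" if xy: "x \<in> ?P" "y \<in> ?P" for x y
    proof -
      obtain m n where mn: "m \<noteq> 0" "n \<noteq> 0" "frag_cmul m x \<in> carrier (resolution1 G)"
        "frag_cmul n y \<in> carrier (resolution1 G)"
        using xy by blast
      have "frag_cmul (m * n) (x + y) = frag_cmul n (frag_cmul m x) + frag_cmul m (frag_cmul n y)"
        by (simp add: frag_cmul_distrib2 mult.commute)
      also have "\<dots> \<in> carrier (resolution1 G)"
        by (rule frag.subspace_add[OF K frag.subspace_scale[OF K mn(3)] frag.subspace_scale[OF K mn(4)]])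
      finally show ?thesis
        using mn(1,2) xy keys_add[of x y] by (auto intro!: exI[of _ "m * n"])
    qed
    show "frag_cmul c x \<in> ?P" if x: "x \<in> ?P" for c x
    proof -
      obtain n where n: "n \<noteq> 0" "frag_cmul n x \<in> carrier (resolution1 G)"
        using x by blast
      have "frag_cmul n (frag_cmul c x) \<in> carrier (resolution1 G)"
        using frag.subspace_scale[OF K n(2), of c] by (simp add: mult.commute)
      then show ?thesis
        using n(1) x keys_cmul[of c x] by blast
    qed
  qed
  have "\<exists>Q. finite Q \<and> Q \<subseteq> ?P \<and> ?P \<subseteq> frag.span Q"
    by (rule frag_subspace_finitely_generated[OF S(1) subP]) simp
  then obtain Q where Q: "finite Q" "Q \<subseteq> ?P" "?P \<subseteq> frag.span Q"
    by blast
  have "\<forall>q\<in>Q. \<exists>n. n \<noteq> 0 \<and> frag_cmul n q \<in> carrier (resolution1 G)"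
    using Q(2) by blast
  then obtain n where n: "\<And>q. q \<in> Q \<Longrightarrow> n q \<noteq> 0" "\<And>q. q \<in> Q \<Longrightarrow> frag_cmul (n q) q \<in> carrier (resolution1 G)"
    by metis
  \<comment> \<open>The intervals are symmetric because \<open>n q\<close> may be negative, and the
    remainder takes the sign of the divisor.\<close>
  have "free_eval G ` ?P \<subseteq>
    (\<lambda>r. free_eval G (\<Sum>q\<in>Q. frag_cmul (r q) q)) ` (\<Pi>\<^sub>E q\<in>Q. {- \<bar>n q\<bar>..\<bar>n q\<bar>})"
  proof
    fix t assume "t \<in> free_eval G ` ?P"
    then obtain u where u: "u \<in> ?P" "t = free_eval G u"
      by blast
    obtain c where c: "u = (\<Sum>q\<in>Q. frag_cmul (c q) q)"
      using u(1) Q(3) frag.span_finite[OF Q(1)] by auto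
    define r where "r = (\<lambda>q\<in>Q. c q mod n q)"
    let ?v = "\<Sum>q\<in>Q. frag_cmul (r q) q"
    have "u - ?v = (\<Sum>q\<in>Q. frag_cmul (c q div n q) (frag_cmul (n q) q))"
      unfolding c sum_subtractf[symmetric]
      by (intro sum.cong refl) (simp add: r_def frag.scale_left_diff_distrib[symmetric] minus_mod_eq_div_mult)
    also have "\<dots> \<in> carrier (resolution1 G)"
      by (rule frag.subspace_sum[OF K], rule frag.subspace_scale[OF K], rule n(2))
    finally have diff: "free_eval G (u - ?v) = \<one>"
      by (simp add: carrier_resolution1)
    have "?v \<in> ?P"
      by (rule frag.subspace_sum[OF subP], rule frag.subspace_scale[OF subP], rule subsetD[OF Q(2)])
    then have v: "Poly_Mapping.keys ?v \<subseteq> carrier G" "Poly_Mapping.keys u \<subseteq> carrier G"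
      using S(2) u(1) by auto
    have "t \<otimes> inv (free_eval G ?v) = \<one>"
      using diff unfolding free_eval_diff[OF v(2,1)] u(2) .
    from inv_equality[OF this] have "t = free_eval G ?v"
      using free_eval_closed[OF v(1)] free_eval_closed[OF v(2)] by (simp add: u(2))
    moreover have "r \<in> (\<Pi>\<^sub>E q\<in>Q. {- \<bar>n q\<bar>..\<bar>n q\<bar>})"
    proof (rule PiE_I)
      fix q assume "q \<in> Q"
      then show "r q \<in> {- \<bar>n q\<bar>..\<bar>n q\<bar>}"
        using abs_mod_less[OF n(1), of q "c q"] by (simp add: r_def abs_less_iff)
    qed (simp add: r_def)
    ultimately show "t \<in> (\<lambda>r. free_eval G (\<Sum>q\<in>Q. frag_cmul (r q) q)) ` (\<Pi>\<^sub>E q\<in>Q. {- \<bar>n q\<bar>..\<bar>n q\<bar>})"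
      by (rule image_eqI)
  qed
  then show ?thesis
    using Q(1) by (rule finite_subset[OF _ finite_imageI[OF finite_PiE]]) auto
qed

section \<open>Inverse limits\<close>

context inverse_system
begin

abbreviation "L \<equiv> inverse_limit A f"

lemma carrier_inverse_limit:
  "x \<in> carrier L \<longleftrightarrow> (\<forall>i. x i \<in> carrier (A i)) \<and> (\<forall>i j. i \<le> j \<longrightarrow> f i j (x j) = x i)"
  by (auto simp: inverse_limit_def PiE_UNIV_domain)

lemma mult_inverse_limit: "x \<otimes>\<^bsub>L\<^esub> y = (\<lambda>i. x i \<otimes>\<^bsub>A i\<^esub> y i)"
  by (simp add: inverse_limit_def restrict_UNIV)

lemma one_inverse_limit: "\<one>\<^bsub>L\<^esub> = (\<lambda>i. \<one>\<^bsub>A i\<^esub>)"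
  by (simp add: inverse_limit_def restrict_UNIV)

lemma group_hom_transition: "i \<le> j \<Longrightarrow> group_hom (A j) (A i) (f i j)"
  using hom comm_group by (simp add: group_hom_def group_hom_axioms_def comm_group_def)

lemma comm_group_inverse_limit: "comm_group L"
proof (rule comm_groupI)
  interpret A: comm_group "A i" for i by (rule comm_group)
  show "x \<otimes>\<^bsub>L\<^esub> y \<in> carrier L" if "x \<in> carrier L" "y \<in> carrier L" for x y
    using that group_hom.hom_mult[OF group_hom_transition]
    by (simp add: carrier_inverse_limit mult_inverse_limit)
  show "\<one>\<^bsub>L\<^esub> \<in> carrier L"
    using group_hom.hom_one[OF group_hom_transition] by (simp add: carrier_inverse_limit one_inverse_limit)
  show "\<exists>y\<in>carrier L. y \<otimes>\<^bsub>L\<^esub> x = \<one>\<^bsub>L\<^esub>" if x: "x \<in> carrier L" for x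
  proof
    show "(\<lambda>i. inv\<^bsub>A i\<^esub> (x i)) \<in> carrier L"
      using x group_hom.hom_inv[OF group_hom_transition] by (simp add: carrier_inverse_limit)
    show "(\<lambda>i. inv\<^bsub>A i\<^esub> (x i)) \<otimes>\<^bsub>L\<^esub> x = \<one>\<^bsub>L\<^esub>"
      using x by (simp add: carrier_inverse_limit mult_inverse_limit one_inverse_limit)
  qed
qed (auto simp: carrier_inverse_limit mult_inverse_limit one_inverse_limit
    comm_group[THEN comm_group.axioms(1), THEN comm_monoid.m_comm]
    monoid.m_assoc[OF comm_monoid.axioms(1)[OF comm_group.axioms(1)[OF comm_group]]]
    monoid.l_one[OF comm_monoid.axioms(1)[OF comm_group.axioms(1)[OF comm_group]]])

lemma projection_hom: "(\<lambda>x. x i) \<in> hom L (A i)"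
  by (auto simp: hom_def carrier_inverse_limit mult_inverse_limit)

text \<open>Two distinct threads differ at some index, and then at every later one, since the
  transition maps would carry an equality down. Summing the witnesses \<open>m\<close> over the
  finitely many pairs bounds them all.\<close>

lemma projections_eventually_injective:
  assumes "finite F" "F \<subseteq> carrier L"
  shows "\<exists>i. \<forall>j\<ge>i. inj_on (\<lambda>a. a j) F"
proof -
  have "\<forall>p::(nat \<Rightarrow> 'a) \<times> (nat \<Rightarrow> 'a). \<exists>i. fst p \<noteq> snd p \<longrightarrow> fst p i \<noteq> snd p i"
    by (auto simp: fun_eq_iff)
  then obtain m where m: "\<And>p::(nat \<Rightarrow> 'a) \<times> (nat \<Rightarrow> 'a). fst p \<noteq> snd p \<Longrightarrow> fst p (m p) \<noteq> snd p (m p)"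
    by metis
  have "a = b" if "a \<in> F" "b \<in> F" "a j = b j" "j \<ge> (\<Sum>p\<in>F \<times> F. m p)" for a b j
  proof (rule ccontr)
    assume "a \<noteq> b"
    have "m (a, b) \<le> (\<Sum>p\<in>F \<times> F. m p)"
      using that assms(1) by (intro member_le_sum) auto
    then have "a (m (a, b)) = b (m (a, b))"
      using that assms(2) unfolding subset_iff carrier_inverse_limit by (metis order_trans)
    then show False
      using m[of "(a, b)"] \<open>a \<noteq> b\<close> by simp
  qed
  then show ?thesis
    by (intro exI[of _ "\<Sum>p\<in>F \<times> F. m p"]) (auto intro!: inj_onI)
qed

text \<open>This is injectivity of K(L) \<otimes> L into the product of the K(A i) \<otimes> A i,
  stated for representatives; it restricts to Tor, a subgroup of the source.\<close>

lemma tensor_relations_limit: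
  assumes X: "Poly_Mapping.keys X \<subseteq> carrier (resolution1 L) \<times> carrier L"
    and rel: "\<And>i. free_map (map_prod (free_map (\<lambda>a. a i)) (\<lambda>a. a i)) X \<in> tensor_relations (resolution1 (A i)) (A i)"
  shows "X \<in> tensor_relations (resolution1 L) L"
proof -
  interpret L: comm_group L by (rule comm_group_inverse_limit)
  interpret A: comm_group "A i" for i by (rule comm_group)
  define S where "S = (\<Union>p\<in>Poly_Mapping.keys X. Poly_Mapping.keys (fst p))"
  define M where "M = carrier (resolution1 L) \<inter> {u. Poly_Mapping.keys u \<subseteq> S}"
  have S: "finite S" "S \<subseteq> carrier L"
    using X by (fastforce simp: S_def carrier_resolution1)+
  have subM: "frag.subspace M"
    unfolding M_def by (rule frag.subspace_inter[OF L.resolution1_subspace frag_subspace_keys])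
  obtain Q where Q: "finite Q" "Q \<subseteq> M" "M \<subseteq> frag.span Q"
    using frag_subspace_finitely_generated[OF S(1) subM] by (auto simp: M_def)
  \<comment> \<open>For the empty set, purity is torsion-freeness, so this extracts a basis of
    \<open>M\<close> from the generators \<open>Q\<close>.\<close>
  obtain E where "finite (E - {})" "E \<subseteq> M" "frag.independent E" "id ` Q \<subseteq> frag.span E"
    using frag_extend_independent[of M "{}" Q id] subM Q(1,2) frag.independent_empty by auto
  then have E: "finite E" "E \<subseteq> M" "frag.independent E" "Q \<subseteq> frag.span E"
    by auto
  have spanE: "frag.span E = M"
    using E(2,4) Q(3) subM by (metis frag.span_minimal frag.span_subspace frag.subspace_span order_trans)
  have EK: "E \<subseteq> carrier (resolution1 L)"
    using E(2) by (auto simp: M_def)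
  have "Poly_Mapping.keys X \<subseteq> frag.span E \<times> carrier L"
    using X unfolding spanE M_def S_def by fastforce
  then obtain \<beta> where \<beta>: "\<beta> ` E \<subseteq> carrier L"
      "X - (\<Sum>k\<in>E. frag_of (k, \<beta> k)) \<in> tensor_relations (resolution1 L) L"
    using tensor_normal_form[OF L.group_resolution1 mult_resolution1 L.resolution1_subspace
        L.group_axioms E(1) EK] by blast
  \<comment> \<open>\<open>P\<close> consists of the formal sums on \<open>S\<close> with a nonzero
    multiple in \<open>M\<close>; their values are the torsion elements of the group generated by
    \<open>S\<close>.\<close>
  define P where "P = {u. Poly_Mapping.keys u \<subseteq> S \<and> (\<exists>n. n \<noteq> 0 \<and> frag_cmul n u \<in> carrier (resolution1 L))}"
  have "finite (insert \<one>\<^bsub>L\<^esub> (S \<union> free_eval L ` P))"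
    using L.finite_torsion[OF S] S(1) by (simp add: P_def)
  moreover have "insert \<one>\<^bsub>L\<^esub> (S \<union> free_eval L ` P) \<subseteq> carrier L"
    using S(2) L.free_eval_closed by (auto simp: P_def)
  ultimately obtain i0 where i0: "\<And>i. i \<ge> i0 \<Longrightarrow> inj_on (\<lambda>a. a i) (insert \<one>\<^bsub>L\<^esub> (S \<union> free_eval L ` P))"
    using projections_eventually_injective by blast
  have large: "\<beta> k i = \<one>\<^bsub>A i\<^esub>" if i: "i \<ge> i0" and k: "k \<in> E" for i k
  proof -
    let ?pr = "\<lambda>a :: nat \<Rightarrow> 'a. a i"
    let ?\<phi> = "free_map ?pr"
    interpret \<phi>: module_hom frag_cmul frag_cmul ?\<phi> by (rule module_hom_free_map)
    have injS: "inj_on ?pr S"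
      using i0[OF i] by (rule inj_on_subset) auto
    have inj: "inj_on ?\<phi> {u. Poly_Mapping.keys u \<subseteq> S}"
      by (rule inj_on_inverseI[of _ "free_map (inv_into S ?pr)"]) (simp add: free_map_inv_into[OF injS])
    have injM: "inj_on ?\<phi> M" and injE: "inj_on ?\<phi> E"
      using E(2) by (auto intro!: inj_on_subset[OF inj] simp: M_def)
    have \<phi>hom: "?\<phi> \<in> hom (resolution1 L) (resolution1 (A i))"
      by (intro free_map_hom_resolution1 comm_group_inverse_limit comm_group projection_hom)
    have \<phi>E: "finite (?\<phi> ` E)" "?\<phi> ` E \<subseteq> carrier (resolution1 (A i))" "frag.independent (?\<phi> ` E)"
      using E(1) EK \<phi>hom \<phi>.independent_injective_image[OF E(3)] injM spanE by (auto simp: hom_def)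
    \<comment> \<open>A multiple of \<open>v\<close> comes from \<open>M\<close>, so
      \<open>v\<close> lifts to some \<open>u\<close> in \<open>P\<close>. The value of
      \<open>u\<close> is torsion and projects to the unit; by the choice of \<open>i0\<close> it is
      the unit, whence \<open>u\<close> lies in \<open>M\<close>.\<close>
    have pure: "v \<in> frag.span (?\<phi> ` E)"
      if n: "n \<noteq> 0" and v: "v \<in> carrier (resolution1 (A i))" and nv: "frag_cmul n v \<in> frag.span (?\<phi> ` E)" for n v
    proof -
      obtain m where m: "m \<in> M" "frag_cmul n v = ?\<phi> m"
        using nv unfolding \<phi>.span_image spanE by blast
      have "Poly_Mapping.keys v = Poly_Mapping.keys (?\<phi> m)"
        using n unfolding m(2)[symmetric] by auto
      also have "\<dots> \<subseteq> ?pr ` S"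
        using m(1) by (intro keys_free_map_subset[where S = S]) (auto simp: M_def)
      finally have v_keys: "Poly_Mapping.keys v \<subseteq> ?pr ` S" .
      define u where "u = free_map (inv_into S ?pr) v"
      have u: "Poly_Mapping.keys u \<subseteq> S" "?\<phi> u = v"
        unfolding u_def using v_keys
        by (rule keys_free_map_subset) (use v_keys in \<open>auto intro: inv_into_into free_map_inv_into'\<close>)
      have "?\<phi> (frag_cmul n u) = ?\<phi> m"
        using u(2) m(2) by (simp add: free_map_cmul)
      then have "frag_cmul n u = m"
        using u(1) m(1) keys_cmul[of n u] by (intro inj_onD[OF inj]) (auto simp: M_def)
      then have "u \<in> P"
        using m(1) n u(1) by (auto simp: P_def M_def)
      have "free_eval L u i = \<one>\<^bsub>A i\<^esub>"
        using L.free_eval_free_map[OF comm_group projection_hom, of u i] u v S(2)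
        by (simp add: carrier_resolution1)
      then have "free_eval L u = \<one>\<^bsub>L\<^esub>"
        using \<open>u \<in> P\<close> by (intro inj_onD[OF i0[OF i]]) (auto simp: one_inverse_limit)
      then have "u \<in> M"
        using u(1) S(2) by (auto simp: M_def carrier_resolution1)
      then show ?thesis
        unfolding \<phi>.span_image spanE using u(2) by blast
    qed
    have "free_map (map_prod ?\<phi> ?pr) (X - (\<Sum>k\<in>E. frag_of (k, \<beta> k))) \<in> tensor_relations (resolution1 (A i)) (A i)"
      by (rule free_map_tensor_relations[OF L.group_resolution1 L.group_axioms A.group_resolution1
            A.group_axioms \<phi>hom projection_hom \<beta>(2)])
    then have "free_map (map_prod ?\<phi> ?pr) (\<Sum>k\<in>E. frag_of (k, \<beta> k)) \<in> tensor_relations (resolution1 (A i)) (A i)"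
      using frag.subspace_diff[OF tensor_relations_subspace[OF A.group_resolution1 A.group_axioms] rel[of i]]
      by (fastforce simp: free_map_diff)
    moreover have "free_map (map_prod ?\<phi> ?pr) (\<Sum>k\<in>E. frag_of (k, \<beta> k))
      = (\<Sum>k\<in>?\<phi> ` E. frag_of (k, \<beta> (inv_into E ?\<phi> k) i))"
      using injE by (simp add: module_hom.sum[OF module_hom_free_map] sum.reindex)
    ultimately have rel': "(\<Sum>k\<in>?\<phi> ` E. frag_of (k, \<beta> (inv_into E ?\<phi> k) i)) \<in> tensor_relations (resolution1 (A i)) (A i)"
      by simp
    have "\<beta> (inv_into E ?\<phi> (?\<phi> k)) i = \<one>\<^bsub>A i\<^esub>"
    proof (rule tensor_pure_independent[OF A.group_resolution1 mult_resolution1 A.resolution1_subspace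
          A.comm_group_axioms \<phi>E])
      show "\<beta> (inv_into E ?\<phi> (?\<phi> k)) i \<in> carrier (A i)"
        using k \<beta>(1) injE by (auto simp: carrier_inverse_limit)
    qed (use pure rel' k in auto)
    then show ?thesis
      using k injE by simp
  qed
  have \<beta>_one: "\<beta> k = \<one>\<^bsub>L\<^esub>" if "k \<in> E" for k
  proof
    fix i
    have "\<beta> k \<in> carrier L"
      using \<beta>(1) that by blast
    \<comment> \<open>For indices below \<open>i0\<close>, the value is transported down from a
      large index.\<close>
    then have "\<beta> k i = f i (max i i0) (\<beta> k (max i i0))"
      by (simp add: carrier_inverse_limit)
    then show "\<beta> k i = \<one>\<^bsub>L\<^esub> i"
      using large[OF _ that, of "max i i0"] group_hom.hom_one[OF group_hom_transition, of i "max i i0"]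
      by (simp add: one_inverse_limit)
  qed
  note R = tensor_relations_subspace[OF L.group_resolution1 L.group_axioms]
  have "frag_of (k, \<one>\<^bsub>L\<^esub>) \<in> tensor_relations (resolution1 L) L" if "k \<in> E" for k
    using frag.subspace_neg[OF R tensor_relations_right[OF L.group_resolution1 L.group_axioms
          _ L.one_closed L.one_closed]] that EK by (auto simp del: minus_diff_eq)
  then have "(\<Sum>k\<in>E. frag_of (k, \<beta> k)) \<in> tensor_relations (resolution1 L) L"
    using \<beta>_one by (intro frag.subspace_sum[OF R]) simp
  then show ?thesis
    using frag.subspace_add[OF R \<beta>(2)] by fastforce
qed

end

text \<open>Compatibility with the transition maps places the family of values in the limit.
  Injectivity follows by applying \<open>tensor_relations_limit\<close> to the difference of two
  representatives.\<close>

theorem corollary6: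
  fixes A :: "nat \<Rightarrow> ('a, 'b) monoid_scheme" and f :: "nat \<Rightarrow> nat \<Rightarrow> 'a \<Rightarrow> 'a"
  assumes "inverse_system A f"
    and "\<And>i. f i (Suc i) ` carrier (A (Suc i)) = carrier (A i)"
  shows "(\<lambda>x i. tor_map (A i) (A i) (\<lambda>a. a i) (\<lambda>a. a i) x)
    \<in> mon (tor (inverse_limit A f) (inverse_limit A f))
          (inverse_limit (\<lambda>i. tor (A i) (A i)) (\<lambda>i j. tor_map (A i) (A i) (f i j) (f i j)))"
proof -
  interpret inverse_system A f by fact
  interpret L: comm_group L by (rule comm_group_inverse_limit)
  interpret A: comm_group "A i" for i by (rule comm_group)
  let ?pr = "\<lambda>i a. a i"
  let ?T = "\<lambda>i. tor_map (A i) (A i) (?pr i) (?pr i)"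
  let ?F = "\<lambda>i. free_map (map_prod (free_map (?pr i)) (?pr i)) :: (((nat \<Rightarrow> 'a) \<Rightarrow>\<^sub>0 int) \<times> (nat \<Rightarrow> 'a) \<Rightarrow>\<^sub>0 int) \<Rightarrow> _"
  note T_class = tor_map_class[OF L.comm_group_axioms L.group_axioms comm_group A.group_axioms
      projection_hom projection_hom]
  have T_hom: "?T i \<in> hom (tor L L) (tor (A i) (A i))" for i
    by (rule tor_map_hom[OF L.comm_group_axioms L.group_axioms comm_group A.group_axioms
          projection_hom projection_hom])
  have compat: "tor_map (A i) (A i) (f i j) (f i j) (?T j x) = ?T i x"
    if x: "x \<in> carrier (tor L L)" and ij: "i \<le> j" for x i j
  proof -
    obtain u where u: "x = tensor_class (resolution1 L) L u"
        "Poly_Mapping.keys u \<subseteq> carrier (resolution1 L) \<times> carrier L"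
      using x unfolding carrier_tor[OF L.comm_group_axioms L.group_axioms] by blast
    \<comment> \<open>Functoriality holds already for formal sums, because the entries of a thread
      satisfy the transition equations.\<close>
    have "free_map (f i j) (free_map (?pr j) v) = free_map (?pr i) v" if "v \<in> carrier (resolution1 L)" for v
      unfolding free_map_free_map using that ij
      by (intro free_map_cong) (auto simp: carrier_resolution1 carrier_inverse_limit subset_iff)
    then have "free_map (map_prod (free_map (f i j)) (f i j)) (?F j u) = ?F i u"
      unfolding free_map_free_map[of "map_prod _ _"] using u(2) ij
      by (intro free_map_cong) (auto simp: carrier_inverse_limit subset_iff)
    then show ?thesis
      by (simp add: u(1) T_class tor_map_class[OF comm_group A.group_axioms comm_group A.group_axioms hom[OF ij] hom[OF ij]])
  qed
  have "(\<lambda>x i. ?T i x) \<in> hom (tor L L) (inverse_limit (\<lambda>i. tor (A i) (A i)) (\<lambda>i j. tor_map (A i) (A i) (f i j) (f i j)))"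
    using T_hom compat by (auto simp: hom_def inverse_limit_def PiE_UNIV_domain Pi_iff)
  moreover have "inj_on (\<lambda>x i. ?T i x) (carrier (tor L L))"
  proof (rule inj_onI)
    fix x y
    assume xy: "x \<in> carrier (tor L L)" "y \<in> carrier (tor L L)" and eq: "(\<lambda>i. ?T i x) = (\<lambda>i. ?T i y)"
    obtain u where u: "x = tensor_class (resolution1 L) L u"
        "Poly_Mapping.keys u \<subseteq> carrier (resolution1 L) \<times> carrier L"
      using xy(1) unfolding carrier_tor[OF L.comm_group_axioms L.group_axioms] by blast
    obtain v where v: "y = tensor_class (resolution1 L) L v"
        "Poly_Mapping.keys v \<subseteq> carrier (resolution1 L) \<times> carrier L"
      using xy(2) unfolding carrier_tor[OF L.comm_group_axioms L.group_axioms] by blast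
    have "?T i x = ?T i y" for i
      using eq by meson
    then have "?F i (u - v) \<in> tensor_relations (resolution1 (A i)) (A i)" for i
      unfolding u(1) v(1) T_class tensor_class_eq_iff[OF A.group_resolution1 A.group_axioms] free_map_diff .
    moreover have "Poly_Mapping.keys (u - v) \<subseteq> carrier (resolution1 L) \<times> carrier L"
      using u(2) v(2) keys_diff[of u v] by blast
    ultimately have "u - v \<in> tensor_relations (resolution1 L) L"
      by (intro tensor_relations_limit)
    then show "x = y"
      unfolding u(1) v(1) tensor_class_eq_iff[OF L.group_resolution1 L.group_axioms] .
  qed
  ultimately show ?thesis
    unfolding mon_def by blast
qed

end
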